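(* Let $(X,d_X)$ be a metric arc and let $s\ge1$. Then $$\|X\|_{s\text{-var}}=H_{1/s}(X)^s$$ (as elements of $[0,+\infty]$). In particular, $X$ is a $(1/s)$-H\"older arc if, and only if, $\|X\|_{s\text{-var}}<\infty$.
   Context: A metric space $X$ is a metric arc if there is a homeomorphism $f$ from $[0,1]$ onto $X$. Given such $f$ and an interval $I\subset[0,1]$, $f(I)$ is a subarc of $X$; if $I$ has endpoints $a,b$, the interior of the subarc $f(I)$ is $f(I\setminus\{a,b\})$. A partition of $X$ is a finite collection $\mathcal{P}=\{X_1,\dots,X_n\}$ of subarcs of $X$ with disjoint interiors whose union is $X$. For $s\ge1$, the $s$-variation of $X$ is $$\|X\|_{s\text{-var}}=\sup_{\mathcal{P}}\sum_{X'\in\mathcal{P}}(\operatorname{diam}X')^s\in[0,+\infty],$$ the supremum being over all partitions of $X$. For $s\ge1$, $H_{1/s}(X)$ is the infimum of all constants $H>0$ for which there is a surjection $f:[0,1]\to X$ with $d_X(f(x),f(y))\le H|x-y|^{1/s}$ for all $x,y\in[0,1]$; if no such $f$ exists, $H_{1/s}(X)=\infty$ (and $\infty^s=\infty$). A map $f:X\to Y$ between metric spaces is $\alpha$-H\"older if there is $C>0$ with $d_Y(f(x_1),f(x_2))\le C\,d_X(x_1,x_2)^\alpha$ for all $x_1,x_2\in X$ (for $\alpha=1$: Lipschitz). A metric space $X$ is an $\alpha$-H\"older arc if there is an $\alpha$-H\"older homeomorphism from $[0,1]$ onto $X$. *)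

theory Defs
  imports "HOL-Analysis.Analysis"
begin

text \<open>
  A metric space is a subset \<open>X\<close> of a type of class \<^class>\<open>metric_space\<close>, with the restricted
  metric.
\<close>

definition metric_arc :: "'a::metric_space set \<Rightarrow> bool" where
  "metric_arc X \<longleftrightarrow> (\<exists>f g. homeomorphism {0..1::real} X f g)"

text \<open>
  \<open>subarc_interior X A J\<close>: \<open>A\<close> is a subarc of \<open>X\<close> and \<open>J\<close> is its interior. This is a relation because
  the interior is introduced through a parametrisation \<open>f\<close> of \<open>X\<close>, on which it does not depend.
  The interval \<open>I\<close> need not be closed, and may be a single point (then \<open>J\<close> is empty).
\<close>
definition subarc_interior :: "'a::metric_space set \<Rightarrow> 'a set \<Rightarrow> 'a set \<Rightarrow> bool" where
  "subarc_interior X A J \<longleftrightarrow>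
     (\<exists>f g I. homeomorphism {0..1::real} X f g \<and>
        I \<subseteq> {0..1} \<and> I \<noteq> {} \<and> is_interval I \<and>
        A = f ` I \<and> J = f ` (I - {Inf I, Sup I}))"

definition subarc :: "'a::metric_space set \<Rightarrow> 'a set \<Rightarrow> bool" where
  "subarc X A \<longleftrightarrow> (\<exists>J. subarc_interior X A J)"

definition arc_partition :: "'a::metric_space set \<Rightarrow> 'a set set \<Rightarrow> bool" where
  "arc_partition X P \<longleftrightarrow>
     finite P \<and> (\<forall>A\<in>P. subarc X A) \<and> \<Union>P = X \<and>
     (\<forall>A\<in>P. \<forall>B\<in>P. A \<noteq> B \<longrightarrow>
        (\<forall>J K. subarc_interior X A J \<longrightarrow> subarc_interior X B K \<longrightarrow> J \<inter> K = {}))"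

definition s_variation :: "real \<Rightarrow> 'a::metric_space set \<Rightarrow> ennreal" where
  "s_variation s X =
     (SUP P\<in>{P. arc_partition X P}. \<Sum>A\<in>P. ennreal (diameter A powr s))"

text \<open>
  The infimum is taken in \<^typ>\<open>ennreal\<close>, so it is \<open>\<infinity>\<close> if there is no such surjection.
\<close>
definition holder_const :: "real \<Rightarrow> 'a::metric_space set \<Rightarrow> ennreal" where
  "holder_const \<alpha> X =
     Inf {ennreal H | H. H > 0 \<and>
       (\<exists>f. f ` {0..1::real} = X \<and>
         (\<forall>x\<in>{0..1}. \<forall>y\<in>{0..1}. dist (f x) (f y) \<le> H * \<bar>x - y\<bar> powr \<alpha>))}"

definition ennreal_powr :: "ennreal \<Rightarrow> real \<Rightarrow> ennreal" where
  "ennreal_powr x s = (if x = \<infinity> then \<infinity> else ennreal (enn2real x powr s))"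

definition holder_on :: "real \<Rightarrow> 'a::metric_space set \<Rightarrow> ('a \<Rightarrow> 'b::metric_space) \<Rightarrow> bool" where
  "holder_on \<alpha> S f \<longleftrightarrow>
     (\<exists>C>0. \<forall>x\<in>S. \<forall>y\<in>S. dist (f x) (f y) \<le> C * dist x y powr \<alpha>)"

definition holder_arc :: "real \<Rightarrow> 'a::metric_space set \<Rightarrow> bool" where
  "holder_arc \<alpha> X \<longleftrightarrow>
     (\<exists>f g. homeomorphism {0..1::real} X f g \<and> holder_on \<alpha> {0..1} f)"

end

theory Submission
  imports Defs
begin

text \<open>
  Fix a parametrisation \<open>\<phi>\<close> of the arc \<open>X\<close> and put \<open>D x y = dist (\<phi> x) (\<phi> y) powr s\<close>. Both sides of the
  identity measure how small the total increase \<open>T 1 - T 0\<close> of a function \<open>T\<close> on \<open>[0,1]\<close> can be if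
  \<open>D x y \<le> T y - T x\<close> whenever \<open>x \<le> y\<close>; call such a \<open>T\<close> a majorant.

  The total increase of a majorant bounds the \<open>s\<close>-variation (\<open>s_variation_le\<close>), because the pieces
  of a partition correspond to subintervals of \<open>[0,1]\<close> with disjoint interiors, and \<open>T\<close> increases on
  each of them by at least the \<open>s\<close>-th power of the diameter of the piece.

  A Hoelder surjection \<open>f\<close> from \<open>[0,1]\<close> onto \<open>X\<close> with constant \<open>H\<close> gives a majorant. It need not be
  injective, but sending \<open>x\<close> to the first time at which \<open>f\<close> passes through \<open>\<phi> x\<close> on its way from one
  end of \<open>X\<close> to the other is, up to reversing time, a monotone right inverse \<open>\<tau>\<close> of \<open>\<phi>\<inverse> \<circ> f\<close>
  (\<open>monotone_section_holder\<close>), and \<open>H powr s * \<tau>\<close> is a majorant of total increase at most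
  \<open>H powr s\<close>. So the variation is at most \<open>H powr s\<close>.

  Conversely, if the variation is a finite number \<open>v\<close>, let \<open>T x\<close> be the supremum of the sums of \<open>D\<close>
  over consecutive points of chains in \<open>[0,x]\<close>. Each chain refines to a partition of \<open>X\<close>
  (\<open>chain_sum_le_s_variation\<close>), so \<open>T\<close> is a majorant of total increase at most \<open>v\<close>. It is strictly
  increasing since \<open>\<phi>\<close> is injective, and it is continuous (\<open>continuous_on_chain_var\<close>), which is the
  heart of the proof. Hence \<open>T\<close>, rescaled to have range \<open>[0,1]\<close>, is a homeomorphism of \<open>[0,1]\<close>, and
  \<open>\<phi>\<close> composed with its inverse is a homeomorphic parametrisation of \<open>X\<close> that is Hoelder with constant
  \<open>v powr (1/s)\<close> (\<open>holder_parametrization\<close>). This gives the other inequality, and the characterisation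
  of Hoelder arcs as well.
\<close>

section \<open>Subarcs and their interiors\<close>

lemma interval_minus_endpoints:
  fixes I :: "real set"
  assumes "is_interval I" "bounded I" "I \<noteq> {}"
  shows "I - {Inf I, Sup I} = {Inf I<..<Sup I}" and "interior I = {Inf I<..<Sup I}"
proof -
  have bdd: "bdd_below I" "bdd_above I"
    using assms(2) by (auto simp: bounded_imp_bdd_below bounded_imp_bdd_above)
  have sub: "{Inf I<..<Sup I} \<subseteq> I"
  proof
    fix x assume x: "x \<in> {Inf I<..<Sup I}"
    obtain a where a: "a \<in> I" "a < x"
      using x cInf_lessD[OF assms(3), of x] by auto
    obtain b where b: "b \<in> I" "x < b"
      using x less_cSupD[OF assms(3), of x] by auto
    show "x \<in> I"
      using assms(1) a b unfolding is_interval_1 by (meson less_imp_le)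
  qed
  show "I - {Inf I, Sup I} = {Inf I<..<Sup I}"
  proof
    show "I - {Inf I, Sup I} \<subseteq> {Inf I<..<Sup I}"
      using cInf_lower[OF _ bdd(1)] cSup_upper[OF _ bdd(2)] by fastforce
  qed (use sub in auto)
  show "interior I = {Inf I<..<Sup I}"
  proof
    show "{Inf I<..<Sup I} \<subseteq> interior I"
      using sub by (simp add: interior_maximal)
    have "interior I \<subseteq> {Inf I..Sup I}"
      using interior_subset cInf_lower[OF _ bdd(1)] cSup_upper[OF _ bdd(2)] by fastforce
    then have "interior I \<subseteq> interior {Inf I..Sup I}"
      by (rule interior_maximal) simp
    then show "interior I \<subseteq> {Inf I<..<Sup I}" by simp
  qed
qed

text \<open>
  This is one-dimensional invariance of domain. It is applied to a reparametrisation of the arc and to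
  its inverse, and so shows that the interior of a subarc is the same for all parametrisations.
\<close>
lemma image_interior_subset:
  fixes h :: "real \<Rightarrow> real"
  assumes "continuous_on S h" "inj_on h S" "I \<subseteq> S"
  shows "h ` interior I \<subseteq> interior (h ` I)"
proof (rule interior_maximal)
  have "interior I \<subseteq> S" using assms(3) interior_subset by blast
  then show "open (h ` interior I)"
    using assms by (intro invariance_of_domain) (auto intro: continuous_on_subset inj_on_subset)
qed (use interior_subset in blast)

lemma homeomorphism_inj_on: "homeomorphism S T f g \<Longrightarrow> inj_on f S"
  by (metis homeomorphism_apply1 inj_onI)

text \<open>
  The parametrisation that witnesses a subarc may be different for each piece of a partition. Here all
  of them are replaced by one given parametrisation \<open>f\<close>: if \<open>f'\<close> is another one, \<open>f\<inverse> \<circ> f'\<close> is a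
  homeomorphism of \<open>[0,1]\<close>, hence maps intervals to intervals and interiors to interiors.
\<close>
lemma subarc_interior_iff:
  assumes hom: "homeomorphism {0..1::real} X f g"
  shows "subarc_interior X A J \<longleftrightarrow>
    (\<exists>I. I \<subseteq> {0..1} \<and> I \<noteq> {} \<and> is_interval I \<and> A = f ` I \<and> J = f ` interior I)"
proof
  assume "subarc_interior X A J"
  then obtain f' g' K where hom': "homeomorphism {0..1::real} X f' g'"
    and K: "K \<subseteq> {0..1}" "K \<noteq> {}" "is_interval K"
      and A: "A = f' ` K" and J: "J = f' ` (K - {Inf K, Sup K})"
    unfolding subarc_interior_def by blast
  have bK: "bounded K" using K(1) bounded_subset bounded_closed_interval by blast
  have J': "J = f' ` interior K"
    using J interval_minus_endpoints[OF K(3) bK K(2)] by simp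
  define h where "h = g \<circ> f'"
  define k where "k = g' \<circ> f"
  have hk: "homeomorphism {0..1} {0..1} h k"
    unfolding h_def k_def
    by (rule homeomorphism_compose[OF hom' homeomorphism_symD[OF hom]])
  have fh: "f (h x) = f' x" if "x \<in> {0..1}" for x
  proof -
    have "f' x \<in> X" using hom' that unfolding homeomorphism_def by blast
    then show ?thesis using homeomorphism_apply2[OF hom] by (simp add: h_def)
  qed
  have fhS: "f ` h ` S = f' ` S" if "S \<subseteq> {0..1}" for S
    using that fh by (force simp: image_iff)
  have sub: "h ` K \<subseteq> {0..1}" using hk K(1) unfolding homeomorphism_def by blast
  have "k (h x) = x" if "x \<in> K" for x
    using homeomorphism_apply1[OF hk] that K(1) by blast
  then have khK: "k ` h ` K = K" by (simp add: image_image)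
  have "h (k y) = y" if "y \<in> interior (h ` K)" for y
    using homeomorphism_apply2[OF hk] that sub interior_subset by blast
  then have "interior (h ` K) = h ` k ` interior (h ` K)" by (simp add: image_image)
  also have "\<dots> \<subseteq> h ` interior K"
    using image_interior_subset[OF homeomorphism_cont2[OF hk]
        homeomorphism_inj_on[OF homeomorphism_symD[OF hk]] sub] khK by (simp add: image_mono)
  finally have "interior (h ` K) = h ` interior K"
    using image_interior_subset[OF homeomorphism_cont1[OF hk] homeomorphism_inj_on[OF hk] K(1)] by blast
  moreover have "is_interval (h ` K)"
    using K hk unfolding is_interval_connected_1 homeomorphism_def
    by (meson connected_continuous_image continuous_on_subset)
  ultimately show "\<exists>I. I \<subseteq> {0..1} \<and> I \<noteq> {} \<and> is_interval I \<and> A = f ` I \<and> J = f ` interior I"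
    using sub K fhS[OF K(1)] fhS[of "interior K"] interior_subset[of K] A J'
    by (intro exI[of _ "h ` K"]) auto
next
  assume "\<exists>I. I \<subseteq> {0..1} \<and> I \<noteq> {} \<and> is_interval I \<and> A = f ` I \<and> J = f ` interior I"
  then obtain I where I: "I \<subseteq> {0..1}" "I \<noteq> {}" "is_interval I" "A = f ` I" "J = f ` interior I"
    by blast
  have "bounded I" using I(1) bounded_subset bounded_closed_interval by blast
  then have "interior I = I - {Inf I, Sup I}"
    using interval_minus_endpoints[OF I(3) _ I(2)] by simp
  then show "subarc_interior X A J"
    unfolding subarc_interior_def using hom I by metis
qed

text \<open>
  The intervals are added in the order of their right endpoints: all earlier ones then lie to the left
  of the current one, so that its left endpoint can serve as the new \<open>hi\<close>. This needs nondegenerate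
  intervals, since disjointness of open intervals says nothing about empty ones.
\<close>
lemma sum_increments_le:
  fixes T :: "real \<Rightarrow> real"
  assumes "finite F" and "mono_on {lo..hi} T" and "lo \<le> hi"
    and "\<And>i. i \<in> F \<Longrightarrow> lo \<le> a i \<and> a i < b i \<and> b i \<le> hi"
    and "\<And>i j. \<lbrakk>i \<in> F; j \<in> F; i \<noteq> j\<rbrakk> \<Longrightarrow> {a i<..<b i} \<inter> {a j<..<b j} = {}"
  shows "(\<Sum>i\<in>F. T (b i) - T (a i)) \<le> T hi - T lo"
  using assms
proof (induction arbitrary: hi rule: finite_ranking_induct[where f = b])
  case empty
  then show ?case by (auto simp: mono_on_def)
next
  case (insert i S)
  have i: "lo \<le> a i" "a i < b i" "b i \<le> hi" using insert.prems by auto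
  show ?case
  proof (cases "i \<in> S")
    case True
    then have "insert i S = S" by auto
    then show ?thesis using insert.prems insert.IH[OF insert.prems(1,2)] by auto
  next
    case False
    have before: "b j \<le> a i" if "j \<in> S" for j
    proof (rule ccontr)
      assume "\<not> b j \<le> a i"
      then have "max (a i) (a j) < b j"
        using that insert.prems(3)[of j] by auto
      then obtain t where "max (a i) (a j) < t" "t < b j" using dense by blast
      moreover have "b j \<le> b i" using insert that by auto
      ultimately have "t \<in> {a i<..<b i} \<inter> {a j<..<b j}" by auto
      moreover have "i \<noteq> j" using that False by blast
      ultimately show False using insert.prems(4)[of i j] that by blast
    qed
    have "(\<Sum>j\<in>S. T (b j) - T (a j)) \<le> T (a i) - T lo"
    proof (rule insert.IH)
      show "mono_on {lo..a i} T"
        using insert.prems(1) by (rule mono_on_subset) (use i in auto)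
    qed (use insert.prems(3,4) before i in auto)
    moreover have "T (b i) \<le> T hi"
      using insert.prems(1) i by (auto simp: mono_on_def)
    ultimately show ?thesis using False insert.hyps(1) by simp
  qed
qed

lemma diameter_le_dist:
  fixes S :: "'a::metric_space set"
  assumes "S \<noteq> {}" "\<And>x y. \<lbrakk>x \<in> S; y \<in> S\<rbrakk> \<Longrightarrow> dist x y \<le> d"
  shows "diameter S \<le> d"
  using assms unfolding diameter_def by (auto intro!: cSUP_least)

text \<open>
  The comparison of the variation with the total increase of a majorant. The pieces need not be closed;
  replacing the interval of a piece by its endpoints \<open>a\<close> and \<open>b\<close> costs nothing because \<open>T\<close> is monotone.
\<close>
lemma s_variation_le:
  fixes X :: "'a::metric_space set" and T :: "real \<Rightarrow> real"
  assumes hom: "homeomorphism {0..1::real} X f g" and s: "s > 0"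
    and T: "\<And>x y. \<lbrakk>0 \<le> x; x \<le> y; y \<le> 1\<rbrakk> \<Longrightarrow> dist (f x) (f y) powr s \<le> T y - T x"
  shows "s_variation s X \<le> ennreal (T 1 - T 0)"
  unfolding s_variation_def
proof (rule SUP_least)
  have mono: "mono_on {0..1} T"
    using T by (intro mono_onI) (smt (verit) atLeastAtMost_iff powr_ge_zero)
  fix P assume "P \<in> {P. arc_partition X P}"
  then have P: "arc_partition X P" by simp
  then have fin: "finite P" and sub: "\<And>A. A \<in> P \<Longrightarrow> subarc X A"
    by (auto simp: arc_partition_def)
  have disj: "J \<inter> K = {}"
    if "A \<in> P" "B \<in> P" "A \<noteq> B" "subarc_interior X A J" "subarc_interior X B K" for A B J K
    using P[unfolded arc_partition_def] that by simp
  have "\<forall>A\<in>P. \<exists>I. I \<subseteq> {0..1} \<and> I \<noteq> {} \<and> is_interval I \<and> A = f ` I"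
    using sub unfolding subarc_def subarc_interior_iff[OF hom] by blast
  then obtain I where
      I: "\<And>A. A \<in> P \<Longrightarrow> I A \<subseteq> {0..1} \<and> I A \<noteq> {} \<and> is_interval (I A)"
      and image: "\<And>A. A \<in> P \<Longrightarrow> f ` I A = A"
    by metis
  define a b where "a A = Inf (I A)" and "b A = Sup (I A)" for A
  have bI: "bounded (I A)" if "A \<in> P" for A
    using I[OF that] bounded_subset bounded_closed_interval by blast
  have range: "a A \<le> x" "x \<le> b A" if "A \<in> P" "x \<in> I A" for A x
    using that bI[OF that(1)] unfolding a_def b_def
    by (auto intro!: cInf_lower cSup_upper bounded_imp_bdd_below bounded_imp_bdd_above)
  have ab: "0 \<le> a A" "a A \<le> b A" "b A \<le> 1" if "A \<in> P" for A
  proof -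
    show "0 \<le> a A" unfolding a_def using I[OF that] by (intro cInf_greatest) auto
    show "b A \<le> 1" unfolding b_def using I[OF that] by (intro cSup_least) auto
    show "a A \<le> b A" using range[OF that] I[OF that] by fastforce
  qed
  have open_disj: "{a A<..<b A} \<inter> {a B<..<b B} = {}" if "A \<in> P" "B \<in> P" "A \<noteq> B" for A B
  proof -
    have int: "interior (I C) = {a C<..<b C}" if "C \<in> P" for C
      unfolding a_def b_def using interval_minus_endpoints(2) I[OF that] bI[OF that] by blast
    have "subarc_interior X C (f ` interior (I C))" if "C \<in> P" for C
      using subarc_interior_iff[OF hom] I[OF that] image[OF that] by blast
    then have "f ` interior (I A) \<inter> f ` interior (I B) = {}"
      using disj that by blast
    then show ?thesis using int that by blast
  qed
  have diam: "diameter A powr s \<le> T (b A) - T (a A)" if A: "A \<in> P" for A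
  proof -
    have le: "dist (f x) (f y) \<le> (T (b A) - T (a A)) powr (1/s)"
      if "x \<in> I A" "y \<in> I A" "x \<le> y" for x y
    proof -
      have "T (a A) \<le> T x" "T y \<le> T (b A)"
        using that range[OF A] ab[OF A] I[OF A] by (auto intro!: mono_onD[OF mono])
      moreover have "dist (f x) (f y) powr s \<le> T y - T x"
        using that I[OF A] by (intro T) auto
      ultimately have "dist (f x) (f y) powr s \<le> T (b A) - T (a A)" by linarith
      then have "(dist (f x) (f y) powr s) powr (1/s) \<le> (T (b A) - T (a A)) powr (1/s)"
        using s by (intro powr_mono2) auto
      then show ?thesis using s by (simp add: powr_powr)
    qed
    have "dist p q \<le> (T (b A) - T (a A)) powr (1/s)" if "p \<in> A" "q \<in> A" for p q
    proof -
      have "p \<in> f ` I A" "q \<in> f ` I A" using that by (simp_all add: image[OF A])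
      then obtain x y where xy: "x \<in> I A" "y \<in> I A" "p = f x" "q = f y" by blast
      then show ?thesis
        using le[of x y] le[of y x] by (cases "x \<le> y") (auto simp: dist_commute)
    qed
    then have "diameter A \<le> (T (b A) - T (a A)) powr (1/s)"
      using I[OF A] image[OF A] by (intro diameter_le_dist) auto
    moreover have "0 \<le> diameter A"
    proof -
      have "bounded (f ` {0..1})"
        by (intro compact_imp_bounded compact_continuous_image homeomorphism_cont1[OF hom]) auto
      then have "bounded A" using I[OF A] image[OF A] by (metis bounded_subset image_mono)
      then show ?thesis by (rule diameter_ge_0)
    qed
    ultimately have "diameter A powr s \<le> ((T (b A) - T (a A)) powr (1/s)) powr s"
      using s by (intro powr_mono2) auto
    also have "\<dots> = T (b A) - T (a A)"
    proof -
      have "T (a A) \<le> T (b A)" using ab[OF A] by (auto intro: mono_onD[OF mono])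
      then show ?thesis using s by (simp add: powr_powr)
    qed
    finally show ?thesis .
  qed
  have "(\<Sum>A\<in>P. diameter A powr s) \<le> (\<Sum>A\<in>P. T (b A) - T (a A))"
    by (intro sum_mono diam)
  \<comment> \<open>One-point pieces contribute nothing and are dropped before the intervals are compared.\<close>
  also have "\<dots> = (\<Sum>A\<in>{A\<in>P. a A < b A}. T (b A) - T (a A))"
    using ab fin by (intro sum.mono_neutral_right) (auto simp: less_le)
  also have "\<dots> \<le> T 1 - T 0"
    using fin mono ab open_disj by (intro sum_increments_le) auto
  finally have "ennreal (\<Sum>A\<in>P. diameter A powr s) \<le> ennreal (T 1 - T 0)"
    by (rule ennreal_leI)
  then show "(\<Sum>A\<in>P. ennreal (diameter A powr s)) \<le> ennreal (T 1 - T 0)"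
    by (simp add: sum_ennreal)
qed

section \<open>Monotone sections of surjections onto an arc\<close>

text \<open>
  The section sends \<open>x\<close> to the first time at which \<open>u\<close> takes the value \<open>x\<close>. It is monotone because
  \<open>u\<close> starts at \<open>0\<close> and so, by the intermediate value theorem, passes through all smaller values before
  it reaches \<open>x\<close>.
\<close>
lemma monotone_section_increasing:
  fixes u :: "real \<Rightarrow> real"
  assumes cont: "continuous_on {p..q} u" and "p \<le> q" and "u p = 0" "u q = 1"
  obtains \<tau> where "mono_on {0..1} \<tau>" "\<And>x. x \<in> {0..1} \<Longrightarrow> \<tau> x \<in> {p..q} \<and> u (\<tau> x) = x"
proof -
  define \<tau> where "\<tau> x = Inf {t \<in> {p..q}. u t = x}" for x
  have bdd: "bdd_below {t \<in> {p..q}. u t = x}" for x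
    by (intro bdd_belowI[of _ p]) auto
  have sec: "\<tau> x \<in> {p..q} \<and> u (\<tau> x) = x" if "x \<in> {0..1}" for x
  proof -
    have "\<exists>t\<ge>p. t \<le> q \<and> u t = x"
      using that assms by (intro IVT') auto
    moreover have "closed {t \<in> {p..q}. u t = x}"
      by (intro continuous_closed_preimage_constant cont) auto
    ultimately have "\<tau> x \<in> {t \<in> {p..q}. u t = x}"
      unfolding \<tau>_def using bdd by (intro closed_contains_Inf) auto
    then show ?thesis by blast
  qed
  have "\<tau> x \<le> \<tau> y" if "x \<in> {0..1}" "y \<in> {0..1}" "x \<le> y" for x y
  proof -
    have "\<exists>t\<ge>p. t \<le> \<tau> y \<and> u t = x"
      using that assms sec[of y] by (intro IVT') (auto intro: continuous_on_subset)
    then obtain t where t: "p \<le> t" "t \<le> \<tau> y" "u t = x" by blast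
    then have "\<tau> x \<le> t"
      unfolding \<tau>_def[of x] using bdd sec[of y] that by (intro cInf_lower) auto
    then show ?thesis using t by simp
  qed
  then show ?thesis using sec by (intro that[of \<tau>]) (auto intro!: mono_onI)
qed

lemma continuous_on_if_holder:
  fixes f :: "real \<Rightarrow> 'a::metric_space"
  assumes "\<alpha> > 0" "\<And>x y. \<lbrakk>x \<in> S; y \<in> S\<rbrakk> \<Longrightarrow> dist (f x) (f y) \<le> H * \<bar>x - y\<bar> powr \<alpha>"
  shows "continuous_on S f"
  unfolding continuous_on_def
proof
  fix x assume x: "x \<in> S"
  have "((\<lambda>y. \<bar>y - x\<bar>) \<longlongrightarrow> 0) (at x within S)"
    by (rule tendsto_eq_intros refl | simp)+
  then have "((\<lambda>y. \<bar>y - x\<bar> powr \<alpha>) \<longlongrightarrow> 0) (at x within S)"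
    by (rule tendsto_zero_powrI) (use assms(1) in auto)
  then have lim: "((\<lambda>y. H * \<bar>y - x\<bar> powr \<alpha>) \<longlongrightarrow> 0) (at x within S)"
    by (rule tendsto_mult_right_zero)
  show "(f \<longlongrightarrow> f x) (at x within S)"
    by (rule metric_tendsto_imp_tendsto[OF lim])
       (use assms(2) x in \<open>auto simp: eventually_at_filter intro!: always_eventually
          intro: order_trans[OF _ abs_ge_self]\<close>)
qed

text \<open>
  A Hoelder surjection may run through the arc back and forth. Restricting it to the times in the range
  of a monotone section recovers \<open>\<phi>\<close> up to a monotone change of time inside an interval of length at
  most \<open>1\<close>.
\<close>
lemma monotone_section_holder:
  fixes X :: "'a::metric_space set"
  assumes hom: "homeomorphism {0..1::real} X \<phi> \<psi>" and "\<alpha> > 0"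
    and surj: "f ` {0..1::real} = X"
    and hold: "\<And>x y. \<lbrakk>x \<in> {0..1}; y \<in> {0..1}\<rbrakk> \<Longrightarrow> dist (f x) (f y) \<le> H * \<bar>x - y\<bar> powr \<alpha>"
  obtains \<tau> where "mono_on {0..1::real} \<tau>" "\<tau> 1 - \<tau> 0 \<le> (1::real)"
    "\<And>x y. \<lbrakk>x \<in> {0..1}; y \<in> {0..1}\<rbrakk> \<Longrightarrow> dist (\<phi> x) (\<phi> y) \<le> H * \<bar>\<tau> x - \<tau> y\<bar> powr \<alpha>"
proof -
  define u where "u = \<psi> \<circ> f"
  have "continuous_on {0..1} f"
    using continuous_on_if_holder[OF \<open>\<alpha> > 0\<close>] hold by blast
  then have contu: "continuous_on {0..1} u"
    unfolding u_def using hom surj by (intro continuous_on_compose) (auto simp: homeomorphism_def)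
  have fu: "\<phi> (u t) = f t" if "t \<in> {0..1}" for t
    unfolding u_def using hom surj that by (auto simp: homeomorphism_def)
  have "u ` {0..1} = {0..1}"
    unfolding u_def image_comp[symmetric] surj using hom by (auto simp: homeomorphism_def)
  then have "0 \<in> u ` {0..1}" "1 \<in> u ` {0..1}" by auto
  then obtain p q where p: "p \<in> {0..1}" "u p = 0" and q: "q \<in> {0..1}" "u q = 1"
    by auto
  show ?thesis
  proof (cases "p \<le> q")
    case True
    have "continuous_on {p..q} u"
      using contu by (rule continuous_on_subset) (use p q in auto)
    then obtain \<tau> where \<tau>: "mono_on {0..1} \<tau>"
        "\<And>x. x \<in> {0..1} \<Longrightarrow> \<tau> x \<in> {p..q} \<and> u (\<tau> x) = x"
      using monotone_section_increasing[OF _ True p(2) q(2)] by blast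
    have in01: "\<tau> x \<in> {0..1}" if "x \<in> {0..1}" for x
      using \<tau>(2)[OF that] p q by auto
    show ?thesis
    proof (rule that[of \<tau>])
      show "dist (\<phi> x) (\<phi> y) \<le> H * \<bar>\<tau> x - \<tau> y\<bar> powr \<alpha>" if "x \<in> {0..1}" "y \<in> {0..1}" for x y
        using hold[of "\<tau> x" "\<tau> y"] fu[of "\<tau> x"] fu[of "\<tau> y"] in01 \<tau>(2) that by auto
    qed (use \<tau> in01[of 0] in01[of 1] in auto)
  next
    case False
    \<comment> \<open>The end \<open>u = 1\<close> is visited first, so time is reversed; the section then takes values in \<open>[-1,0]\<close>.\<close>
    have "continuous_on {-p..-q} (\<lambda>t. u (- t))"
      using p q by (intro continuous_on_compose2[OF contu]) (auto intro!: continuous_intros)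
    then obtain \<tau> where \<tau>: "mono_on {0..1} \<tau>"
        "\<And>x. x \<in> {0..1} \<Longrightarrow> \<tau> x \<in> {-p..-q} \<and> u (- \<tau> x) = x"
      using monotone_section_increasing[of "-p" "-q" "\<lambda>t. u (- t)"] False p q by auto
    have in01: "- \<tau> x \<in> {0..1}" if "x \<in> {0..1}" for x
      using \<tau>(2)[OF that] p q by auto
    show ?thesis
    proof (rule that[of \<tau>])
      show "dist (\<phi> x) (\<phi> y) \<le> H * \<bar>\<tau> x - \<tau> y\<bar> powr \<alpha>" if "x \<in> {0..1}" "y \<in> {0..1}" for x y
        using hold[of "- \<tau> x" "- \<tau> y"] fu[of "- \<tau> x"] fu[of "- \<tau> y"] in01 \<tau>(2) that
        by (auto simp: abs_minus_commute)
    qed (use \<tau> in01[of 0] in01[of 1] in auto)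
  qed
qed

section \<open>The variation of a chain function on an interval\<close>

fun chain_sum :: "('a \<Rightarrow> 'a \<Rightarrow> real) \<Rightarrow> 'a list \<Rightarrow> real" where
  "chain_sum D (x # y # zs) = D x y + chain_sum D (y # zs)"
| "chain_sum D _ = 0"

definition chains :: "real \<Rightarrow> real \<Rightarrow> real list set" where
  "chains a b = {xs. sorted xs \<and> set xs \<subseteq> {a..b}}"

definition chain_var :: "(real \<Rightarrow> real \<Rightarrow> real) \<Rightarrow> real \<Rightarrow> real \<Rightarrow> real" where
  "chain_var D a b = (SUP xs\<in>chains a b. chain_sum D xs)"

lemma chain_sum_append_ge:
  assumes "\<And>x y. D x y \<ge> 0"
  shows "chain_sum D xs + chain_sum D ys \<le> chain_sum D (xs @ ys)"
proof (induction xs rule: induct_list012)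
  case (2 x)
  then show ?case using assms by (cases ys) auto
qed auto

lemma continuous_on_chain_sum:
  fixes c :: "'b::topological_space \<Rightarrow> 'a::topological_space \<Rightarrow> 'a"
  assumes D: "continuous_on (S \<times> S) (\<lambda>p. D (fst p) (snd p))"
    and c: "\<And>t. t \<in> set xs \<Longrightarrow> continuous_on U (\<lambda>y. c y t)"
    and S: "\<And>t y. \<lbrakk>t \<in> set xs; y \<in> U\<rbrakk> \<Longrightarrow> c y t \<in> S"
  shows "continuous_on U (\<lambda>y. chain_sum D (map (c y) xs))"
  using c S
proof (induction xs rule: induct_list012)
  case (3 t t' ts)
  have "continuous_on U (\<lambda>y. D (fst (c y t, c y t')) (snd (c y t, c y t')))"
    by (rule continuous_on_compose2[OF D]) (use 3 in \<open>auto intro!: continuous_intros\<close>)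
  then show ?case using 3 by (auto intro!: continuous_intros)
qed auto

text \<open>
  Cutting all steps of a chain at \<open>x\<close> splits it into a chain below and a chain above \<open>x\<close>. Only the
  one step that straddles \<open>x\<close>, if there is one, is changed by this, so the error \<open>\<omega>\<close> enters at most
  once. The case distinction in the conclusion lets the induction keep track of whether the straddling
  step is still to come.
\<close>
lemma chain_sum_split:
  fixes D :: "real \<Rightarrow> real \<Rightarrow> real"
  assumes nonneg: "\<And>x y. D x y \<ge> 0" and refl: "\<And>x. D x x = 0" and "\<omega> \<ge> 0"
    and \<omega>: "\<And>a b. \<lbrakk>lo \<le> a; a \<le> x; x \<le> b; b \<le> hi\<rbrakk> \<Longrightarrow> D a b \<le> D a x + \<omega>"
    and "xs \<in> chains lo hi"
  shows "chain_sum D xs \<le> chain_sum D (map (min x) xs) + chain_sum D (map (max x) xs)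
           + (if \<forall>t\<in>set xs. x \<le> t then 0 else \<omega>)"
  using \<open>xs \<in> chains lo hi\<close>
proof (induction xs rule: induct_list012)
  case (3 a b ts)
  then have IH: "chain_sum D (b # ts) \<le> chain_sum D (map (min x) (b # ts))
      + chain_sum D (map (max x) (b # ts)) + (if \<forall>t\<in>set (b # ts). x \<le> t then 0 else \<omega>)"
    and ab: "a \<le> b" "lo \<le> a" "b \<le> hi" and ts: "\<forall>t\<in>set ts. b \<le> t"
    by (auto simp: chains_def)
  consider "x \<le> a" | "a < x" "b < x" | "a < x" "x \<le> b" by linarith
  then show ?case
  proof cases
    case 1
    then have "\<forall>t\<in>set (b # ts). x \<le> t" using ab ts by fastforce
    moreover have "min x a = x" "min x b = x" "max x a = a" "max x b = b" using 1 ab by auto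
    ultimately show ?thesis using IH 1 ab refl[of x] by auto
  next
    case 2
    then have "min x a = a" "min x b = b" "max x a = x" "max x b = x" by auto
    then show ?thesis using IH 2 refl[of x] by auto
  next
    case 3
    then have "\<forall>t\<in>set (b # ts). x \<le> t" using ab ts by fastforce
    moreover have "D a b \<le> D a x + \<omega>" using 3 ab by (intro \<omega>) auto
    moreover have "min x a = a" "min x b = x" "max x a = x" "max x b = b" using 3 by auto
    ultimately show ?thesis using IH 3 nonneg[of x b] by auto
  qed
qed (use \<open>\<omega> \<ge> 0\<close> in auto)

text \<open>
  The model is \<open>D x y = dist (\<phi> x) (\<phi> y) powr s\<close>. For \<open>s > 1\<close> inserting a point into a chain may
  decrease its sum, so the variation is only superadditive in the interval. Its continuity therefore
  does not reduce to small intervals and uses the continuity of \<open>D\<close> in both arguments.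
\<close>
locale chain_variation =
  fixes D :: "real \<Rightarrow> real \<Rightarrow> real" and B :: real
  assumes D_nonneg: "\<And>x y. D x y \<ge> 0" and D_refl: "\<And>x. D x x = 0"
    and D_cont: "continuous_on ({0..1} \<times> {0..1}) (\<lambda>p. D (fst p) (snd p))"
    and bound: "\<And>xs. xs \<in> chains 0 1 \<Longrightarrow> chain_sum D xs \<le> B"
begin

lemma chains_mono: "\<lbrakk>a' \<le> a; b \<le> b'\<rbrakk> \<Longrightarrow> chains a b \<subseteq> chains a' b'"
  unfolding chains_def by force

lemma chains_nonempty: "chains a b \<noteq> {}"
  unfolding chains_def by (auto intro: exI[of _ "[]"])

lemma chain_sum_le_var:
  assumes "0 \<le> a" "b \<le> 1" "xs \<in> chains a b"
  shows "chain_sum D xs \<le> chain_var D a b"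
  unfolding chain_var_def using assms chains_mono[of 0 a b 1] bound
  by (intro cSUP_upper) (auto intro!: bdd_aboveI2[where M = B])

lemma chain_var_leI: "(\<And>xs. xs \<in> chains a b \<Longrightarrow> chain_sum D xs \<le> C) \<Longrightarrow> chain_var D a b \<le> C"
  unfolding chain_var_def using chains_nonempty by (intro cSUP_least) auto

lemma chain_var_superadditive:
  assumes "0 \<le> a" "b \<le> c" "c \<le> 1" "a \<le> b"
  shows "chain_var D a b + chain_var D b c \<le> chain_var D a c"
proof -
  have *: "chain_sum D xs + chain_sum D ys \<le> chain_var D a c"
    if "xs \<in> chains a b" "ys \<in> chains b c" for xs ys
  proof -
    have "xs @ ys \<in> chains a c"
      using that assms unfolding chains_def by (fastforce simp: sorted_append)
    then show ?thesis
      using chain_sum_append_ge[of D xs ys] D_nonneg chain_sum_le_var[of a c "xs @ ys"] assms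
      by force
  qed
  have "chain_var D a b \<le> chain_var D a c - chain_sum D ys" if "ys \<in> chains b c" for ys
    by (rule chain_var_leI) (use *[OF _ that] in \<open>simp add: algebra_simps\<close>)
  then have "chain_var D b c \<le> chain_var D a c - chain_var D a b"
    by (intro chain_var_leI) (simp add: algebra_simps)
  then show ?thesis by simp
qed

lemma D_le_chain_var: "\<lbrakk>0 \<le> x; x \<le> y; y \<le> 1\<rbrakk> \<Longrightarrow> D x y \<le> chain_var D x y"
  using chain_sum_le_var[of x y "[x, y]"] by (auto simp: chains_def)

lemma chain_var_increment:
  assumes "0 \<le> x" "x \<le> y" "y \<le> 1"
  shows "D x y \<le> chain_var D 0 y - chain_var D 0 x"
  using chain_var_superadditive[of 0 x y] D_le_chain_var[of x y] assms by simp

lemma chain_var_mono_right: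
  "\<lbrakk>0 \<le> x; x \<le> y; y \<le> 1\<rbrakk> \<Longrightarrow> chain_var D 0 x \<le> chain_var D 0 y"
  using chain_var_increment[of x y] D_nonneg[of x y] by simp

lemma less_chain_varD:
  assumes "c < chain_var D a b"
  obtains xs where "xs \<in> chains a b" "c < chain_sum D xs"
  using assms chain_var_leI[of a b c] by (meson not_le)

text \<open>
  Truncating an almost optimal chain at \<open>y\<close> changes its sum continuously, by continuity of \<open>D\<close>, and
  for \<open>y = x\<close> does not change the chain. So the variation on \<open>[0,x]\<close> cannot be much larger than the
  variation on \<open>[0,y]\<close> for \<open>y\<close> close to \<open>x\<close>. The next lemma is the mirror image.
\<close>
lemma chain_var_lsc_right:
  assumes x: "x \<in> {0..1}" and c: "c < chain_var D 0 x"
  shows "\<forall>\<^sub>F y in at x within {0..1}. c < chain_var D 0 y"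
proof -
  obtain xs where xs: "xs \<in> chains 0 x" "c < chain_sum D xs"
    using c by (rule less_chain_varD)
  have xs01: "t \<in> {0..x}" if "t \<in> set xs" for t using that xs by (auto simp: chains_def)
  have "continuous_on {0..1} (\<lambda>y. chain_sum D (map (min y) xs))"
    by (rule continuous_on_chain_sum[OF D_cont])
       (use xs01 x in \<open>auto intro!: continuous_intros simp: min_le_iff_disj\<close>)
  then have "((\<lambda>y. chain_sum D (map (min y) xs)) \<longlongrightarrow> chain_sum D (map (min x) xs))
      (at x within {0..1})"
    using x by (simp add: continuous_on_def)
  moreover have "map (min x) xs = xs" using xs01 by (intro map_idI) auto
  ultimately have "\<forall>\<^sub>F y in at x within {0..1}. c < chain_sum D (map (min y) xs)"
    using xs(2) by (auto dest: order_tendstoD)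
  moreover have "\<forall>\<^sub>F y in at x within {0..1}. y \<in> {0..1}"
    by (simp add: eventually_at_filter)
  ultimately show ?thesis
  proof eventually_elim
    case (elim y)
    have "sorted (map (min y) xs)"
      using xs(1) by (auto simp: chains_def sorted_map intro: sorted_wrt_mono_rel[rotated])
    then have "map (min y) xs \<in> chains 0 y"
      using xs01 elim by (auto simp: chains_def)
    then show ?case using elim chain_sum_le_var[of 0 y "map (min y) xs"] by auto
  qed
qed

lemma chain_var_lsc_left:
  assumes x: "x \<in> {0..1}" and c: "c < chain_var D x 1"
  shows "\<forall>\<^sub>F y in at x within {0..1}. c < chain_var D y 1"
proof -
  obtain xs where xs: "xs \<in> chains x 1" "c < chain_sum D xs"
    using c by (rule less_chain_varD)
  have xs01: "t \<in> {x..1}" if "t \<in> set xs" for t using that xs by (auto simp: chains_def)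
  have "continuous_on {0..1} (\<lambda>y. chain_sum D (map (max y) xs))"
    by (rule continuous_on_chain_sum[OF D_cont])
       (use xs01 x in \<open>auto intro!: continuous_intros simp: le_max_iff_disj\<close>)
  then have "((\<lambda>y. chain_sum D (map (max y) xs)) \<longlongrightarrow> chain_sum D (map (max x) xs))
      (at x within {0..1})"
    using x by (simp add: continuous_on_def)
  moreover have "map (max x) xs = xs" using xs01 by (intro map_idI) auto
  ultimately have "\<forall>\<^sub>F y in at x within {0..1}. c < chain_sum D (map (max y) xs)"
    using xs(2) by (auto dest: order_tendstoD)
  moreover have "\<forall>\<^sub>F y in at x within {0..1}. y \<in> {0..1}"
    by (simp add: eventually_at_filter)
  ultimately show ?thesis
  proof eventually_elim
    case (elim y)
    have "sorted (map (max y) xs)"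
      using xs(1) by (auto simp: chains_def sorted_map intro: sorted_wrt_mono_rel[rotated])
    then have "map (max y) xs \<in> chains y 1"
      using xs01 elim by (auto simp: chains_def)
    then show ?case using elim chain_sum_le_var[of y 1 "map (max y) xs"] by auto
  qed
qed

lemma chain_var_split:
  assumes "0 \<le> x" "x \<le> y" "y \<le> 1" "\<omega> \<ge> 0"
    and \<omega>: "\<And>a b. \<lbrakk>0 \<le> a; a \<le> x; x \<le> b; b \<le> y\<rbrakk> \<Longrightarrow> D a b \<le> D a x + \<omega>"
  shows "chain_var D 0 y \<le> chain_var D 0 x + chain_var D x y + \<omega>"
proof (rule chain_var_leI)
  fix xs assume xs: "xs \<in> chains 0 y"
  have "sorted (map (min x) xs)" "sorted (map (max x) xs)"
    using xs by (auto simp: chains_def sorted_map intro: sorted_wrt_mono_rel[rotated])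
  then have "map (min x) xs \<in> chains 0 x" "map (max x) xs \<in> chains x y"
    using xs assms by (auto simp: chains_def)
  then have "chain_sum D (map (min x) xs) \<le> chain_var D 0 x"
      "chain_sum D (map (max x) xs) \<le> chain_var D x y"
    using assms by (auto intro!: chain_sum_le_var)
  then show "chain_sum D xs \<le> chain_var D 0 x + chain_var D x y + \<omega>"
    using chain_sum_split[of D \<omega> 0 x y xs] D_nonneg D_refl assms(4) \<omega> xs
    by (auto split: if_splits)
qed

text \<open>
  Lower semicontinuity is \<open>chain_var_lsc_right\<close>. For upper semicontinuity only \<open>y > x\<close> matters. Then the
  increase of the variation from \<open>[0,x]\<close> to \<open>[0,y]\<close> is at most the variation on \<open>[x,y]\<close> plus the error
  of a straddling step, which uniform continuity of \<open>D\<close> makes small. By superadditivity the variation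
  on \<open>[x,y]\<close> is at most the amount by which the variation on \<open>[y,1]\<close> falls short of that on \<open>[x,1]\<close>,
  and this is small by \<open>chain_var_lsc_left\<close>.
\<close>
lemma continuous_on_chain_var: "continuous_on {0..1} (chain_var D 0)"
  unfolding continuous_on_def
proof (intro ballI order_tendstoI)
  fix x c assume x: "x \<in> {0..1::real}" and c: "chain_var D 0 x < c"
  define e where "e = (c - chain_var D 0 x) / 2"
  have e: "e > 0" using c by (simp add: e_def)
  have "uniformly_continuous_on ({0..1} \<times> {0..1}) (\<lambda>p. D (fst p) (snd p))"
    by (intro compact_uniformly_continuous D_cont compact_Times) auto
  then obtain d where d: "d > 0" and dD: "\<And>p p'. \<lbrakk>p \<in> {0..1} \<times> {0..1}; p' \<in> {0..1} \<times> {0..1};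
      dist p' p < d\<rbrakk> \<Longrightarrow> dist (D (fst p') (snd p')) (D (fst p) (snd p)) < e"
    using e unfolding uniformly_continuous_on_def by metis
  have "\<forall>\<^sub>F y in at x within {0..1}. chain_var D x 1 - e < chain_var D y 1"
    using x e by (intro chain_var_lsc_left) auto
  moreover have "\<forall>\<^sub>F y in at x within {0..1}. y \<in> {0..1} \<and> dist y x < d"
    using d by (auto simp: eventually_at)
  ultimately show "\<forall>\<^sub>F y in at x within {0..1}. chain_var D 0 y < c"
  proof eventually_elim
    case (elim y)
    show ?case
    proof (cases "y \<le> x")
      case True
      then show ?thesis using chain_var_mono_right[of y x] elim x c by auto
    next
      case False
      have "D a b \<le> D a x + e" if "0 \<le> a" "a \<le> x" "x \<le> b" "b \<le> y" for a b
        using dD[of "(a, x)" "(a, b)"] that x elim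
        by (auto simp: dist_Pair_Pair dist_real_def)
      then have "chain_var D 0 y \<le> chain_var D 0 x + chain_var D x y + e"
        using False x elim e by (intro chain_var_split) auto
      moreover have "chain_var D x y + chain_var D y 1 \<le> chain_var D x 1"
        using False x elim by (intro chain_var_superadditive) auto
      ultimately show ?thesis using elim by (auto simp: e_def field_simps)
    qed
  qed
next
  fix x c assume "x \<in> {0..1::real}" and "c < chain_var D 0 x"
  then show "\<forall>\<^sub>F y in at x within {0..1}. c < chain_var D 0 y"
    by (rule chain_var_lsc_right)
qed

end

section \<open>From chains to partitions\<close>

text \<open>
  A chain may repeat points and need not end at \<open>hi\<close>. Keeping degenerate intervals \<open>u = v\<close> in \<open>Q\<close>
  makes \<open>Q\<close> cover \<open>hi\<close> even if the chain reaches \<open>hi\<close> early. The steps from a point to itself are left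
  out, so that every interval occurs only once in the set \<open>Q\<close>.
\<close>
lemma chain_refines_to_division:
  fixes D :: "real \<Rightarrow> real \<Rightarrow> real"
  assumes nonneg: "\<And>x y. D x y \<ge> 0" and refl: "\<And>x. D x x = 0"
    and "lo \<le> hi" "xs \<in> chains lo hi"
  shows "\<exists>Q. finite Q \<and> (\<forall>(u, v)\<in>Q. lo \<le> u \<and> u \<le> v \<and> v \<le> hi) \<and>
      (\<Union>(u, v)\<in>Q. {u..v}) = {lo..hi} \<and>
      pairwise (\<lambda>(u, v) (u', v'). {u<..<v} \<inter> {u'<..<v'} = {}) Q \<and>
      chain_sum D (lo # xs) \<le> (\<Sum>(u, v)\<in>Q. D u v)"
  using assms(3,4)
proof (induction xs arbitrary: lo)
  case Nil
  then show ?case using nonneg by (intro exI[of _ "{(lo, hi)}"]) auto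
next
  case (Cons y ys)
  have y: "lo \<le> y" "y \<le> hi" "ys \<in> chains y hi"
    using Cons.prems by (auto simp: chains_def)
  obtain Q where Q: "finite Q" "\<forall>(u, v)\<in>Q. y \<le> u \<and> u \<le> v \<and> v \<le> hi"
      "(\<Union>(u, v)\<in>Q. {u..v}) = {y..hi}"
      "pairwise (\<lambda>(u, v) (u', v'). {u<..<v} \<inter> {u'<..<v'} = {}) Q"
      "chain_sum D (y # ys) \<le> (\<Sum>(u, v)\<in>Q. D u v)"
    using Cons.IH[OF y(2,3)] by blast
  show ?case
  proof (cases "lo = y")
    case True
    then show ?thesis using Q refl by (intro exI[of _ Q]) auto
  next
    case False
    then have "lo < y" using y by simp
    then have notin: "(lo, y) \<notin> Q" using Q(2) by auto
    have "(\<Union>(u, v)\<in>insert (lo, y) Q. {u..v}) = {lo..hi}"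
      using Q(3) y by auto
    moreover have "pairwise (\<lambda>(u, v) (u', v'). {u<..<v} \<inter> {u'<..<v'} = {}) (insert (lo, y) Q)"
      using Q(2,4) by (auto simp: pairwise_insert)
    moreover have "chain_sum D (lo # y # ys) \<le> (\<Sum>(u, v)\<in>insert (lo, y) Q. D u v)"
      using Q(1,5) notin by simp
    moreover have "\<forall>(u, v)\<in>insert (lo, y) Q. lo \<le> u \<and> u \<le> v \<and> v \<le> hi"
      using Q(2) y by auto
    ultimately show ?thesis
      using Q(1) by (intro exI[of _ "insert (lo, y) Q"] conjI) auto
  qed
qed

text \<open>
  The images under \<open>f\<close> of the closed intervals of a division of \<open>[0,1]\<close> form a partition of \<open>X\<close>, and
  the diameter of each image is at least the distance of its endpoints.
\<close>
lemma chain_sum_le_s_variation: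
  fixes X :: "'a::metric_space set"
  assumes hom: "homeomorphism {0..1::real} X f g" and s: "s > 0" and xs: "xs \<in> chains 0 1"
  shows "ennreal (chain_sum (\<lambda>x y. dist (f x) (f y) powr s) xs) \<le> s_variation s X"
proof -
  define D where "D x y = dist (f x) (f y) powr s" for x y
  define arc where "arc = (\<lambda>(u, v). f ` {u..v})"
  have nonneg: "D x y \<ge> 0" and refl: "D x x = 0" for x y
    using s by (auto simp: D_def)
  obtain Q where Q: "finite Q" "\<forall>(u, v)\<in>Q. 0 \<le> u \<and> u \<le> v \<and> v \<le> 1"
      "(\<Union>(u, v)\<in>Q. {u..v}) = {0..1}"
      "pairwise (\<lambda>(u, v) (u', v'). {u<..<v} \<inter> {u'<..<v'} = {}) Q"
      "chain_sum D (0 # xs) \<le> (\<Sum>(u, v)\<in>Q. D u v)"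
    using chain_refines_to_division[of D 0 1 xs, OF nonneg refl _ xs] by auto
  have inj: "inj_on f {0..1}" using hom by (rule homeomorphism_inj_on)
  have bnd: "bounded (f ` {0..1})"
    by (intro compact_imp_bounded compact_continuous_image homeomorphism_cont1[OF hom]) auto
  have inj_arc: "inj_on arc Q"
  proof (rule inj_onI)
    fix p q assume p: "p \<in> Q" and q: "q \<in> Q" and eq: "arc p = arc q"
    obtain u v where p': "p = (u, v)" by (cases p)
    obtain u' v' where q': "q = (u', v')" by (cases q)
    have "{u..v} = {u'..v'}"
      using eq p q Q(2) unfolding p' q' arc_def
      by (intro inj_on_image_eq_iff[OF inj, THEN iffD1]) auto
    then show "p = q"
      using Q(2) p q unfolding p' q' by (auto simp: Icc_eq_Icc)
  qed
  have interior: "J = f ` {u<..<v}" if uv: "(u, v) \<in> Q" and J: "subarc_interior X (arc (u, v)) J"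
    for u v J
  proof -
    obtain I where I: "I \<subseteq> {0..1}" "f ` {u..v} = f ` I" "J = f ` interior I"
      using J subarc_interior_iff[OF hom] by (auto simp: arc_def)
    then have "{u..v} = I"
      using uv Q(2) by (intro inj_on_image_eq_iff[OF inj, THEN iffD1]) auto
    then show ?thesis using I(3) by auto
  qed
  have "arc_partition X (arc ` Q)"
    unfolding arc_partition_def
  proof (intro conjI ballI impI allI)
    fix A assume "A \<in> arc ` Q"
    then obtain u v where "(u, v) \<in> Q" "A = f ` {u..v}" by (auto simp: arc_def)
    then show "subarc X A"
      using Q(2) unfolding subarc_def subarc_interior_iff[OF hom]
      by (intro exI[of _ "f ` interior {u..v}"] exI[of _ "{u..v}"]) (auto simp: is_interval_cc)
  next
    have "\<Union> (arc ` Q) = f ` (\<Union>(u, v)\<in>Q. {u..v})" by (auto simp: arc_def)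
    then show "\<Union> (arc ` Q) = X" using Q(3) hom by (simp add: homeomorphism_def)
  next
    fix A B J K
    assume A: "A \<in> arc ` Q" and B: "B \<in> arc ` Q" and "A \<noteq> B"
      and J: "subarc_interior X A J" and K: "subarc_interior X B K"
    obtain u v where uv: "(u, v) \<in> Q" "A = arc (u, v)" using A by auto
    obtain u' v' where uv': "(u', v') \<in> Q" "B = arc (u', v')" using B by auto
    have "{u<..<v} \<inter> {u'<..<v'} = {}"
      using pairwiseD[OF Q(4) uv(1) uv'(1)] \<open>A \<noteq> B\<close> uv uv' by auto
    moreover have "{u<..<v} \<subseteq> {0..1}" "{u'<..<v'} \<subseteq> {0..1}"
      using Q(2) uv uv' by auto
    ultimately have "f ` {u<..<v} \<inter> f ` {u'<..<v'} = {}"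
      using inj_on_image_Int[OF inj, of "{u<..<v}" "{u'<..<v'}"] by simp
    then show "J \<inter> K = {}" using interior uv uv' J K by simp
  qed (use Q(1) in simp)
  then have part: "(\<Sum>A\<in>arc ` Q. ennreal (diameter A powr s)) \<le> s_variation s X"
    unfolding s_variation_def by (intro SUP_upper) simp
  have "chain_sum D xs \<le> chain_sum D (0 # xs)"
    using nonneg by (cases xs) auto
  also have "\<dots> \<le> (\<Sum>(u, v)\<in>Q. D u v)" by (rule Q(5))
  also have "\<dots> \<le> (\<Sum>p\<in>Q. diameter (arc p) powr s)"
  proof (rule sum_mono, clarify)
    fix u v assume uv: "(u, v) \<in> Q"
    have "bounded (f ` {u..v})"
      using Q(2) uv by (intro bounded_subset[OF bnd]) auto
    then have "dist (f u) (f v) \<le> diameter (f ` {u..v})"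
      using Q(2) uv by (intro diameter_bounded_bound) auto
    then show "D u v \<le> diameter (arc (u, v)) powr s"
      using s by (auto simp: D_def arc_def intro!: powr_mono2)
  qed
  also have "\<dots> = (\<Sum>A\<in>arc ` Q. diameter A powr s)"
    using inj_arc by (simp add: sum.reindex)
  finally have "ennreal (chain_sum D xs) \<le> (\<Sum>A\<in>arc ` Q. ennreal (diameter A powr s))"
    by (simp add: sum_ennreal ennreal_leI)
  then show ?thesis using part unfolding D_def by simp
qed

section \<open>Variation and Hoelder parametrisations\<close>

text \<open>
  The parametrisation of \<open>X\<close> by its normalised variation: \<open>h x\<close> is the share of the total variation
  that lies on \<open>[0,x]\<close>.
\<close>
lemma holder_parametrization:
  fixes X :: "'a::metric_space set"
  assumes hom: "homeomorphism {0..1::real} X \<phi> \<psi>" and s: "s > 0"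
    and v: "s_variation s X = ennreal v" "v \<ge> 0"
  shows "v > 0" and "\<exists>F G. homeomorphism {0..1::real} X F G \<and>
    (\<forall>x\<in>{0..1}. \<forall>y\<in>{0..1}. dist (F x) (F y) \<le> v powr (1/s) * \<bar>x - y\<bar> powr (1/s))"
proof -
  define D where "D x y = dist (\<phi> x) (\<phi> y) powr s" for x y
  have inj: "inj_on \<phi> {0..1}" using hom by (rule homeomorphism_inj_on)
  have contD: "continuous_on ({0..1} \<times> {0..1}) (\<lambda>p. D (fst p) (snd p))"
    unfolding D_def using s homeomorphism_cont1[OF hom]
    by (intro continuous_on_powr' continuous_on_dist continuous_on_const)
       (auto intro!: continuous_on_compose2[of "{0..1}" \<phi>] continuous_intros)
  interpret chain_variation D v
  proof
    show "chain_sum D xs \<le> v" if "xs \<in> chains 0 1" for xs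
      using chain_sum_le_s_variation[OF hom s that] v unfolding D_def by simp
  qed (use s contD in \<open>auto simp: D_def\<close>)
  define T where "T = chain_var D 0"
  have T: "D x y \<le> T y - T x" if "0 \<le> x" "x \<le> y" "y \<le> 1" for x y
    unfolding T_def using that by (rule chain_var_increment)
  have D_pos: "D x y > 0" if "0 \<le> x" "x < y" "y \<le> 1" for x y
    using that inj unfolding D_def inj_on_def by fastforce
  have strict: "T x < T y" if "0 \<le> x" "x < y" "y \<le> 1" for x y
    using T[of x y] D_pos[of x y] that by simp
  have "T 1 \<le> v" unfolding T_def using bound by (intro chain_var_leI)
  moreover have "0 \<le> T 0"
    using chain_sum_le_var[of 0 0 "[]"] by (simp add: T_def chains_def)
  ultimately have total: "T 1 - T 0 \<le> v" by simp
  have pos: "0 < T 1 - T 0" using strict[of 0 1] by simp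
  show "v > 0" using pos total by simp
  define h where "h x = (T x - T 0) / (T 1 - T 0)" for x
  have conth: "continuous_on {0..1} h"
    unfolding h_def T_def using pos continuous_on_chain_var
    by (intro continuous_intros) (auto simp: T_def)
  have stricth: "h x < h y" if "0 \<le> x" "x < y" "y \<le> 1" for x y
    using strict[OF that] pos by (simp add: h_def divide_strict_right_mono)
  have "inj_on h {0..1}"
    using stricth by (intro linorder_inj_onI) (auto simp: less_le)
  moreover have "h ` {0..1} = {0..1}"
  proof
    have ends: "h 0 = 0" "h 1 = 1" using pos by (auto simp: h_def)
    show "{0..1} \<subseteq> h ` {0..1}"
    proof
      fix c assume "c \<in> {0..1::real}"
      then have "\<exists>x\<ge>0. x \<le> 1 \<and> h x = c" using conth ends by (intro IVT') auto
      then show "c \<in> h ` {0..1}" by auto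
    qed
    show "h ` {0..1} \<subseteq> {0..1}"
      using stricth[of 0] stricth[of _ 1] ends by (fastforce simp: le_less)
  qed
  ultimately obtain k where hk: "homeomorphism {0..1} {0..1} h k"
    using homeomorphism_compact[OF compact_Icc conth] by blast
  have hom': "homeomorphism {0..1} X (\<phi> \<circ> k) (h \<circ> \<psi>)"
    by (rule homeomorphism_compose[OF homeomorphism_symD[OF hk] hom])
  have le: "dist (\<phi> x) (\<phi> y) \<le> v powr (1/s) * \<bar>h x - h y\<bar> powr (1/s)"
    if "0 \<le> x" "x \<le> y" "y \<le> 1" for x y
  proof -
    have "T x \<le> T y" using strict[of x y] that by (cases "x = y") auto
    have "D x y \<le> T y - T x" using that by (rule T)
    also have "\<dots> = (T 1 - T 0) * \<bar>h x - h y\<bar>"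
      using pos \<open>T x \<le> T y\<close> by (simp add: h_def diff_divide_distrib[symmetric])
    also have "\<dots> \<le> v * \<bar>h x - h y\<bar>" using total by (intro mult_right_mono) auto
    finally have "D x y powr (1/s) \<le> (v * \<bar>h x - h y\<bar>) powr (1/s)"
      using s by (intro powr_mono2) (auto simp: D_def)
    then show ?thesis using s v(2) by (simp add: D_def powr_powr powr_mult)
  qed
  have "dist ((\<phi> \<circ> k) x) ((\<phi> \<circ> k) y) \<le> v powr (1/s) * \<bar>x - y\<bar> powr (1/s)"
    if xy: "x \<in> {0..1}" "y \<in> {0..1}" for x y
  proof -
    have "k x \<in> {0..1}" "k y \<in> {0..1}" "h (k x) = x" "h (k y) = y"
      using hk xy unfolding homeomorphism_def by auto
    then show ?thesis
      using le[of "k x" "k y"] le[of "k y" "k x"]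
      by (cases "k x \<le> k y") (auto simp: dist_commute abs_minus_commute)
  qed
  then show "\<exists>F G. homeomorphism {0..1::real} X F G \<and>
    (\<forall>x\<in>{0..1}. \<forall>y\<in>{0..1}. dist (F x) (F y) \<le> v powr (1/s) * \<bar>x - y\<bar> powr (1/s))"
    using hom' by blast
qed

lemma s_variation_le_holder:
  fixes X :: "'a::metric_space set"
  assumes arc: "metric_arc X" and s: "s > 0" and H: "H \<ge> 0"
    and surj: "f ` {0..1::real} = X"
    and hold: "\<And>x y. \<lbrakk>x \<in> {0..1}; y \<in> {0..1}\<rbrakk> \<Longrightarrow> dist (f x) (f y) \<le> H * \<bar>x - y\<bar> powr (1/s)"
  shows "s_variation s X \<le> ennreal (H powr s)"
proof -
  obtain \<phi> \<psi> where hom: "homeomorphism {0..1::real} X \<phi> \<psi>"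
    using arc unfolding metric_arc_def by blast
  obtain \<tau> where mono: "mono_on {0..1::real} \<tau>" and len: "\<tau> 1 - \<tau> 0 \<le> (1::real)"
    and \<tau>: "\<And>x y. \<lbrakk>x \<in> {0..1}; y \<in> {0..1}\<rbrakk> \<Longrightarrow>
      dist (\<phi> x) (\<phi> y) \<le> H * \<bar>\<tau> x - \<tau> y\<bar> powr (1/s)"
    using monotone_section_holder[OF hom _ surj hold] s by (metis zero_less_divide_1_iff)
  have "s_variation s X \<le> ennreal (H powr s * \<tau> 1 - H powr s * \<tau> 0)"
  proof (rule s_variation_le[OF hom s])
    fix x y :: real assume xy: "0 \<le> x" "x \<le> y" "y \<le> 1"
    have "\<tau> x \<le> \<tau> y" using xy by (auto intro!: mono_onD[OF mono])
    have "dist (\<phi> x) (\<phi> y) powr s \<le> (H * \<bar>\<tau> x - \<tau> y\<bar> powr (1/s)) powr s"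
      using xy s by (intro powr_mono2 \<tau>) auto
    also have "\<dots> = H powr s * (\<tau> y - \<tau> x)"
      using s H \<open>\<tau> x \<le> \<tau> y\<close> by (simp add: powr_mult powr_powr)
    finally show "dist (\<phi> x) (\<phi> y) powr s \<le> H powr s * \<tau> y - H powr s * \<tau> x"
      by (simp add: right_diff_distrib)
  qed
  also have "\<dots> \<le> ennreal (H powr s)"
    using mult_left_mono[OF len, of "H powr s"] by (intro ennreal_leI) (simp add: right_diff_distrib)
  finally show ?thesis .
qed

lemma s_variation_eq_holder_const:
  fixes X :: "'a::metric_space set"
  assumes arc: "metric_arc X" and s: "s > 0"
  shows "s_variation s X = ennreal_powr (holder_const (1/s) X) s"
proof (rule antisym)
  obtain \<phi> \<psi> where hom: "homeomorphism {0..1::real} X \<phi> \<psi>"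
    using arc unfolding metric_arc_def by blast
  show "s_variation s X \<le> ennreal_powr (holder_const (1/s) X) s"
  proof (cases "holder_const (1/s) X")
    case (real c)
    have bound: "s_variation s X \<le> ennreal (H powr s)" if "H > 0" "f ` {0..1::real} = X"
      "\<forall>x\<in>{0..1}. \<forall>y\<in>{0..1}. dist (f x) (f y) \<le> H * \<bar>x - y\<bar> powr (1/s)" for H f
      using s_variation_le_holder[OF arc s _ that(2)] that by auto
    have "\<exists>H f. H > 0 \<and> f ` {0..1::real} = X \<and>
        (\<forall>x\<in>{0..1}. \<forall>y\<in>{0..1}. dist (f x) (f y) \<le> H * \<bar>x - y\<bar> powr (1/s))"
    proof (rule ccontr)
      assume "\<not> ?thesis"
      then have "holder_const (1/s) X = Inf {}"
        unfolding holder_const_def by (intro arg_cong[where f = Inf]) blast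
      then show False using real by simp
    qed
    then have "s_variation s X < \<infinity>"
      using bound by (metis ennreal_less_top infinity_ennreal_def le_less_trans)
    then obtain v where v: "v \<ge> 0" "s_variation s X = ennreal v"
      by (cases "s_variation s X") auto
    \<comment> \<open>Taking \<open>s\<close>-th roots first lets the infimum be handled by its defining property alone.\<close>
    have "ennreal (v powr (1/s)) \<le> holder_const (1/s) X"
      unfolding holder_const_def
    proof (rule Inf_greatest, clarify)
      fix H f assume H: "H > 0" "X = f ` {0..1::real}"
        "\<forall>x\<in>{0..1}. \<forall>y\<in>{0..1}. dist (f x) (f y) \<le> H * \<bar>x - y\<bar> powr (1/s)"
      then have "ennreal v \<le> ennreal (H powr s)" using bound v by metis
      then have "v \<le> H powr s" by simp
      then have "v powr (1/s) \<le> (H powr s) powr (1/s)" using v s by (intro powr_mono2) auto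
      then show "ennreal (v powr (1/s)) \<le> ennreal H"
        using s H by (intro ennreal_leI) (simp add: powr_powr)
    qed
    then have "v powr (1/s) \<le> c" using real by simp
    then have "(v powr (1/s)) powr s \<le> c powr s" using s by (intro powr_mono2) auto
    then have "v \<le> c powr s" using s v by (simp add: powr_powr)
    then show ?thesis using real v by (simp add: ennreal_powr_def)
  qed (simp add: ennreal_powr_def)
  show "ennreal_powr (holder_const (1/s) X) s \<le> s_variation s X"
  proof (cases "s_variation s X")
    case (real v)
    obtain F G where F: "homeomorphism {0..1::real} X F G"
      "\<forall>x\<in>{0..1}. \<forall>y\<in>{0..1}. dist (F x) (F y) \<le> v powr (1/s) * \<bar>x - y\<bar> powr (1/s)"
      and "v > 0"
      using holder_parametrization[OF hom s real(2,1)] by blast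
    have "F ` {0..1} = X" using F(1) by (simp add: homeomorphism_def)
    then have "holder_const (1/s) X \<le> ennreal (v powr (1/s))"
      unfolding holder_const_def using F(2) \<open>v > 0\<close>
      by (intro Inf_lower CollectI exI[of _ "v powr (1/s)"]) auto
    then obtain c where c: "holder_const (1/s) X = ennreal c" "0 \<le> c" "c \<le> v powr (1/s)"
      by (cases "holder_const (1/s) X") (auto simp: top_unique)
    then have "c powr s \<le> (v powr (1/s)) powr s" using s by (intro powr_mono2) auto
    then show ?thesis using c s real by (simp add: ennreal_powr_def powr_powr ennreal_leI)
  qed simp
qed

theorem proposition2p1:
  fixes X :: "'a::metric_space set" and s :: real
  assumes "metric_arc X" and "s \<ge> 1"
  shows "s_variation s X = ennreal_powr (holder_const (1 / s) X) s \<and>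
         (holder_arc (1 / s) X \<longleftrightarrow> s_variation s X < \<infinity>)"
proof (intro conjI iffI)
  have s: "s > 0" using assms(2) by simp
  show "s_variation s X = ennreal_powr (holder_const (1 / s) X) s"
    using assms(1) s by (rule s_variation_eq_holder_const)
  show "s_variation s X < \<infinity>" if hold: "holder_arc (1 / s) X"
  proof -
    obtain f g C where hom: "homeomorphism {0..1::real} X f g" and C: "C > 0"
      "\<forall>x\<in>{0..1}. \<forall>y\<in>{0..1}. dist (f x) (f y) \<le> C * dist x y powr (1/s)"
      using hold unfolding holder_arc_def holder_on_def by blast
    have "s_variation s X \<le> ennreal (C powr s)"
      using C hom by (intro s_variation_le_holder[OF assms(1) s, of C f])
        (auto simp: homeomorphism_def dist_real_def)
    then show ?thesis using le_less_trans by fastforce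
  qed
  show "holder_arc (1 / s) X" if fin: "s_variation s X < \<infinity>"
  proof -
    obtain v where v: "v \<ge> 0" "s_variation s X = ennreal v"
      using fin by (cases "s_variation s X") auto
    obtain \<phi> \<psi> where "homeomorphism {0..1::real} X \<phi> \<psi>"
      using assms(1) unfolding metric_arc_def by blast
    then obtain F G where "homeomorphism {0..1::real} X F G"
      "\<forall>x\<in>{0..1}. \<forall>y\<in>{0..1}. dist (F x) (F y) \<le> v powr (1/s) * \<bar>x - y\<bar> powr (1/s)"
      and "v > 0"
      using holder_parametrization[OF _ s v(2,1)] by blast
    then show ?thesis
      unfolding holder_arc_def holder_on_def
      by (intro exI[of _ F] exI[of _ G] conjI exI[of _ "v powr (1/s)"]) (auto simp: dist_real_def)
  qed
qed

end
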